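(* Let $n\ge1$ and let $\Bbbk$ be a field. The Loewy length of $\Bbbk\,\mathcal{EC}_n$, and hence of $\Bbbk\,\mathcal{PC}_n$, is $\binom n2+1$.
   Context: $[n]=\{1,\dots,n\}$. $\mathcal{PC}_n$ is the monoid of all partial functions $f$ on $[n]$ that are order-preserving ($x\le y\Rightarrow f(x)\le f(y)$ for $x,y$ in the domain) and order-decreasing ($f(x)\le x$ for $x$ in the domain); $\Bbbk\mathcal{PC}_n$ is its monoid algebra. $\mathcal{EC}_n$ is the category whose objects are all subsets of $[n]$ and whose morphisms $A\to B$ are the order-preserving and order-decreasing onto functions with domain $A$ and range $B$. The category algebra $\Bbbk\mathcal{EC}_n$ has basis the morphisms, with product $m'\cdot m=m'm$ if the composition is defined and $0$ otherwise. It is known that $\Bbbk\mathcal{PC}_n\simeq\Bbbk\mathcal{EC}_n$ as algebras. The Loewy length of a finite-dimensional algebra $A$ is the minimal integer $m$ with $\mathrm{Rad}^mA=0$. *)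

theory Defs
  imports "HOL-Algebra.Ideal_Product" "HOL-Library.Poly_Mapping"
begin

section \<open>Jacobson radical and Loewy length\<close>

definition left_ideal :: "'a set \<Rightarrow> ('a, 'b) ring_scheme \<Rightarrow> bool" where
  "left_ideal I R \<longleftrightarrow>
     additive_subgroup I R \<and> (\<forall>a\<in>I. \<forall>x\<in>carrier R. x \<otimes>\<^bsub>R\<^esub> a \<in> I)"

definition maximal_left_ideal :: "'a set \<Rightarrow> ('a, 'b) ring_scheme \<Rightarrow> bool" where
  "maximal_left_ideal I R \<longleftrightarrow>
     left_ideal I R \<and> I \<noteq> carrier R \<and>
     (\<forall>J. left_ideal J R \<and> I \<subseteq> J \<longrightarrow> J = I \<or> J = carrier R)"

definition jacobson_radical :: "('a, 'b) ring_scheme \<Rightarrow> 'a set" where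
  "jacobson_radical R = carrier R \<inter> \<Inter> {I. maximal_left_ideal I R}"

text \<open>
  Powers are taken in the monoid of two-sided ideals of \<open>R\<close>, so the zeroth power of the
  radical is \<open>carrier R\<close>. A relation is used instead of \<open>LEAST\<close>, so that
  nilpotency of the radical is part of the assertion.
\<close>

definition has_loewy_length :: "('a, 'b) ring_scheme \<Rightarrow> nat \<Rightarrow> bool" where
  "has_loewy_length R m \<longleftrightarrow>
     jacobson_radical R [^]\<^bsub>ideals_set R\<^esub> m = {\<zero>\<^bsub>R\<^esub>} \<and>
     (\<forall>k<m. jacobson_radical R [^]\<^bsub>ideals_set R\<^esub> k \<noteq> {\<zero>\<^bsub>R\<^esub>})"


section \<open>Monoid algebras and category algebras\<close>

text \<open>
  Formal linear combinations are finitely supported functions (\<open>keys\<close> is the support),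
  and \<open>Poly_Mapping.single x r\<close> stands for \<open>r x\<close>. The products below are the
  bilinear extensions of the product of basis elements.
\<close>

definition monoid_algebra :: "('m, 'b) monoid_scheme \<Rightarrow> ('m \<Rightarrow>\<^sub>0 'k::field) ring" where
  "monoid_algebra M =
     \<lparr>carrier = {a. Poly_Mapping.keys a \<subseteq> carrier M},
      mult = (\<lambda>a b. \<Sum>x\<in>Poly_Mapping.keys a. \<Sum>y\<in>Poly_Mapping.keys b.
                Poly_Mapping.single (x \<otimes>\<^bsub>M\<^esub> y) (Poly_Mapping.lookup a x * Poly_Mapping.lookup b y)),
      one = Poly_Mapping.single \<one>\<^bsub>M\<^esub> 1,
      zero = 0,
      add = (+)\<rparr>"

text \<open>
  \<open>Comp C g f\<close> is the composite \<open>g \<circ> f\<close>, meaningful when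
  \<open>Dom C g = Cod C f\<close>.
\<close>

record ('o, 'm) category =
  Obj :: "'o set"
  Mor :: "'m set"
  Dom :: "'m \<Rightarrow> 'o"
  Cod :: "'m \<Rightarrow> 'o"
  Ident :: "'o \<Rightarrow> 'm"
  Comp :: "'m \<Rightarrow> 'm \<Rightarrow> 'm"

locale finite_category =
  fixes C :: "('o, 'm) category"
  assumes finite_Obj: "finite (Obj C)"
    and finite_Mor: "finite (Mor C)"
    and Dom_in: "f \<in> Mor C \<Longrightarrow> Dom C f \<in> Obj C"
    and Cod_in: "f \<in> Mor C \<Longrightarrow> Cod C f \<in> Obj C"
    and Ident_in: "A \<in> Obj C \<Longrightarrow> Ident C A \<in> Mor C"
    and Dom_Ident: "A \<in> Obj C \<Longrightarrow> Dom C (Ident C A) = A"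
    and Cod_Ident: "A \<in> Obj C \<Longrightarrow> Cod C (Ident C A) = A"
    and Comp_in: "f \<in> Mor C \<Longrightarrow> g \<in> Mor C \<Longrightarrow> Dom C g = Cod C f \<Longrightarrow> Comp C g f \<in> Mor C"
    and Dom_Comp: "f \<in> Mor C \<Longrightarrow> g \<in> Mor C \<Longrightarrow> Dom C g = Cod C f \<Longrightarrow> Dom C (Comp C g f) = Dom C f"
    and Cod_Comp: "f \<in> Mor C \<Longrightarrow> g \<in> Mor C \<Longrightarrow> Dom C g = Cod C f \<Longrightarrow> Cod C (Comp C g f) = Cod C g"
    and Comp_Ident_left: "f \<in> Mor C \<Longrightarrow> Comp C (Ident C (Cod C f)) f = f"
    and Comp_Ident_right: "f \<in> Mor C \<Longrightarrow> Comp C f (Ident C (Dom C f)) = f"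
    and Comp_assoc: "f \<in> Mor C \<Longrightarrow> g \<in> Mor C \<Longrightarrow> h \<in> Mor C \<Longrightarrow> Dom C g = Cod C f \<Longrightarrow>
          Dom C h = Cod C g \<Longrightarrow> Comp C (Comp C h g) f = Comp C h (Comp C g f)"

definition category_algebra :: "('o, 'm) category \<Rightarrow> ('m \<Rightarrow>\<^sub>0 'k::field) ring" where
  "category_algebra C =
     \<lparr>carrier = {a. Poly_Mapping.keys a \<subseteq> Mor C},
      mult = (\<lambda>a b. \<Sum>g\<in>Poly_Mapping.keys a. \<Sum>f\<in>Poly_Mapping.keys b.
                if Dom C g = Cod C f
                then Poly_Mapping.single (Comp C g f) (Poly_Mapping.lookup a g * Poly_Mapping.lookup b f) else 0),
      one = (\<Sum>A\<in>Obj C. Poly_Mapping.single (Ident C A) 1),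
      zero = 0,
      add = (+)\<rparr>"


section \<open>The monoid \<open>PC\<close> and the category \<open>EC\<close>\<close>

definition order_preserving :: "(nat \<rightharpoonup> nat) \<Rightarrow> bool" where
  "order_preserving f \<longleftrightarrow> mono_on (dom f) (\<lambda>x. the (f x))"

definition order_decreasing :: "(nat \<rightharpoonup> nat) \<Rightarrow> bool" where
  "order_decreasing f \<longleftrightarrow> (\<forall>x\<in>dom f. the (f x) \<le> x)"

text \<open>
  Products are composed right to left, \<open>(g \<circ>\<^sub>m f) x = g (f x)\<close>, with the
  natural domain.
\<close>

definition PC :: "nat \<Rightarrow> (nat \<rightharpoonup> nat) monoid" where
  "PC n =
     \<lparr>carrier = {f. dom f \<subseteq> {1..n} \<and> ran f \<subseteq> {1..n} \<and>
                    order_preserving f \<and> order_decreasing f},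
      mult = (\<lambda>g f. g \<circ>\<^sub>m f),
      one = Some |` {1..n}\<rparr>"

definition EC_hom :: "nat set \<Rightarrow> nat set \<Rightarrow> (nat \<rightharpoonup> nat) set" where
  "EC_hom A B = {f. dom f = A \<and> ran f = B \<and> order_preserving f \<and> order_decreasing f}"

text \<open>
  A morphism is onto, so it determines its source and target as its domain and range.
\<close>

definition EC :: "nat \<Rightarrow> (nat set, nat \<rightharpoonup> nat) category" where
  "EC n =
     \<lparr>Obj = Pow {1..n},
      Mor = (\<Union>A\<in>Pow {1..n}. \<Union>B\<in>Pow {1..n}. EC_hom A B),
      Dom = dom,
      Cod = ran,
      Ident = (\<lambda>A. Some |` A),
      Comp = (\<lambda>g f. g \<circ>\<^sub>m f)\<rparr>"


section \<open>Well-formedness\<close>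

text \<open>
  \<open>pmul D p\<close> is the bilinear extension of a partial product \<open>p\<close> with
  domain of definition \<open>D\<close>; both algebra products above are instances.
\<close>

definition pmul :: "('m \<Rightarrow> 'm \<Rightarrow> bool) \<Rightarrow> ('m \<Rightarrow> 'm \<Rightarrow> 'm) \<Rightarrow>
    ('m \<Rightarrow>\<^sub>0 'k::field) \<Rightarrow> ('m \<Rightarrow>\<^sub>0 'k) \<Rightarrow> ('m \<Rightarrow>\<^sub>0 'k)" where
  "pmul D p a b = (\<Sum>x\<in>Poly_Mapping.keys a. \<Sum>y\<in>Poly_Mapping.keys b.
     if D x y then Poly_Mapping.single (p x y) (Poly_Mapping.lookup a x * Poly_Mapping.lookup b y) else 0)"

lemma pmul_superset:
  assumes "finite S" "finite T" "Poly_Mapping.keys a \<subseteq> S" "Poly_Mapping.keys b \<subseteq> T"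
  shows "pmul D p a b = (\<Sum>x\<in>S. \<Sum>y\<in>T.
     if D x y then Poly_Mapping.single (p x y) (Poly_Mapping.lookup a x * Poly_Mapping.lookup b y) else 0)"
proof -
  have "pmul D p a b = (\<Sum>x\<in>S. \<Sum>y\<in>Poly_Mapping.keys b.
     if D x y then Poly_Mapping.single (p x y) (Poly_Mapping.lookup a x * Poly_Mapping.lookup b y) else 0)"
    unfolding pmul_def using assms
    by (intro sum.mono_neutral_left) (auto simp: in_keys_iff intro!: sum.neutral)
  also have "\<dots> = (\<Sum>x\<in>S. \<Sum>y\<in>T.
     if D x y then Poly_Mapping.single (p x y) (Poly_Mapping.lookup a x * Poly_Mapping.lookup b y) else 0)"
    using assms by (intro sum.cong refl sum.mono_neutral_left) (auto simp: in_keys_iff)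
  finally show ?thesis .
qed

lemma pmul_add_left: "pmul D p (a + b) c = pmul D p a c + pmul D p b c"
proof -
  let ?S = "Poly_Mapping.keys a \<union> Poly_Mapping.keys b" and ?T = "Poly_Mapping.keys c"
  have k: "Poly_Mapping.keys (a + b) \<subseteq> ?S" by (rule keys_add)
  show ?thesis
    by (simp add: pmul_superset[of ?S ?T] k flip: sum.distrib)
      (auto simp: lookup_add distrib_right single_add intro!: sum.cong)
qed

lemma pmul_add_right: "pmul D p c (a + b) = pmul D p c a + pmul D p c b"
proof -
  let ?T = "Poly_Mapping.keys a \<union> Poly_Mapping.keys b" and ?S = "Poly_Mapping.keys c"
  have k: "Poly_Mapping.keys (a + b) \<subseteq> ?T" by (rule keys_add)
  show ?thesis
    by (simp add: pmul_superset[of ?S ?T] k flip: sum.distrib)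
      (auto simp: lookup_add distrib_left single_add intro!: sum.cong)
qed

lemma pmul_zero [simp]: "pmul D p 0 c = 0" "pmul D p c 0 = 0"
  by (simp_all add: pmul_def)

lemma pmul_sum_left: "pmul D p (sum f S) c = (\<Sum>i\<in>S. pmul D p (f i) c)"
  by (induction S rule: infinite_finite_induct) (simp_all add: pmul_add_left)

lemma pmul_sum_right: "pmul D p c (sum f S) = (\<Sum>i\<in>S. pmul D p c (f i))"
  by (induction S rule: infinite_finite_induct) (simp_all add: pmul_add_right)

lemma pmul_single:
  "pmul D p (Poly_Mapping.single x r) (Poly_Mapping.single y s) =
     (if D x y then Poly_Mapping.single (p x y) (r * s) else 0)"
  by (subst pmul_superset[of "{x}" "{y}"]) auto

lemma expand_singles: "a = (\<Sum>x\<in>Poly_Mapping.keys a. Poly_Mapping.single x (Poly_Mapping.lookup a x))"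
  by (rule poly_mapping_eqI)
    (auto simp: lookup_sum lookup_single when_def in_keys_iff sum.delta)

lemma pmul_assoc:
  assumes "\<And>x y z. \<lbrakk>x \<in> M; y \<in> M; z \<in> M; D x y; D y z\<rbrakk> \<Longrightarrow>
             D (p x y) z \<and> D x (p y z) \<and> p (p x y) z = p x (p y z)"
    and "\<And>x y z. \<lbrakk>x \<in> M; y \<in> M; z \<in> M; D x y; D (p x y) z\<rbrakk> \<Longrightarrow> D y z"
    and "\<And>x y z. \<lbrakk>x \<in> M; y \<in> M; z \<in> M; D y z; D x (p y z)\<rbrakk> \<Longrightarrow> D x y"
    and "Poly_Mapping.keys a \<subseteq> M" "Poly_Mapping.keys b \<subseteq> M" "Poly_Mapping.keys c \<subseteq> M"
  shows "pmul D p (pmul D p a b) c = pmul D p a (pmul D p b c)"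
proof -
  let ?s = "\<lambda>a x. Poly_Mapping.single x (Poly_Mapping.lookup a x)"
  have "pmul D p (pmul D p (?s a x) (?s b y)) (?s c z) =
        pmul D p (?s a x) (pmul D p (?s b y) (?s c z))"
    if "x \<in> Poly_Mapping.keys a" "y \<in> Poly_Mapping.keys b" "z \<in> Poly_Mapping.keys c" for x y z
  proof -
    have "x \<in> M" "y \<in> M" "z \<in> M" using that assms(4-6) by auto
    then show ?thesis
      using assms(1)[of x y z] assms(2)[of x y z] assms(3)[of x y z]
      by (auto simp: pmul_single mult.assoc)
  qed
  note 0 = this
  have 1: "pmul D p (pmul D p (?s a x) (?s b y)) c = pmul D p (?s a x) (pmul D p (?s b y) c)"
    if "x \<in> Poly_Mapping.keys a" "y \<in> Poly_Mapping.keys b" for x y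
  proof -
    have "pmul D p (pmul D p (?s a x) (?s b y)) (sum (?s c) (Poly_Mapping.keys c)) =
          pmul D p (?s a x) (pmul D p (?s b y) (sum (?s c) (Poly_Mapping.keys c)))"
      unfolding pmul_sum_right by (intro sum.cong refl 0 that)
    then show ?thesis by (simp only: flip: expand_singles)
  qed
  have 2: "pmul D p (pmul D p (?s a x) b) c = pmul D p (?s a x) (pmul D p b c)"
    if "x \<in> Poly_Mapping.keys a" for x
  proof -
    have "pmul D p (pmul D p (?s a x) (sum (?s b) (Poly_Mapping.keys b))) c =
          pmul D p (?s a x) (pmul D p (sum (?s b) (Poly_Mapping.keys b)) c)"
      unfolding pmul_sum_right pmul_sum_left by (intro sum.cong refl 1 that)
    then show ?thesis by (simp only: flip: expand_singles)
  qed
  have "pmul D p (pmul D p (sum (?s a) (Poly_Mapping.keys a)) b) c =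
        pmul D p (sum (?s a) (Poly_Mapping.keys a)) (pmul D p b c)"
    unfolding pmul_sum_left by (intro sum.cong refl 2)
  then show ?thesis by (simp only: flip: expand_singles)
qed

lemma keys_pmul:
  assumes "\<And>x y. \<lbrakk>x \<in> M; y \<in> M; D x y\<rbrakk> \<Longrightarrow> p x y \<in> M" "Poly_Mapping.keys a \<subseteq> M" "Poly_Mapping.keys b \<subseteq> M"
  shows "Poly_Mapping.keys (pmul D p a b) \<subseteq> M"
proof -
  have s: "Poly_Mapping.keys (sum f S) \<subseteq> M" if "\<And>i. i \<in> S \<Longrightarrow> Poly_Mapping.keys (f i) \<subseteq> M"
    for f :: "'a \<Rightarrow> 'a \<Rightarrow>\<^sub>0 'b" and S
    using keys_sum[of f S] that by blast
  show ?thesis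
    unfolding pmul_def using assms by (intro s) (auto split: if_splits)
qed

lemma ring_pmul:
  assumes "\<And>x y. \<lbrakk>x \<in> M; y \<in> M; D x y\<rbrakk> \<Longrightarrow> p x y \<in> M"
    and "\<And>x y z. \<lbrakk>x \<in> M; y \<in> M; z \<in> M; D x y; D y z\<rbrakk> \<Longrightarrow>
             D (p x y) z \<and> D x (p y z) \<and> p (p x y) z = p x (p y z)"
    and "\<And>x y z. \<lbrakk>x \<in> M; y \<in> M; z \<in> M; D x y; D (p x y) z\<rbrakk> \<Longrightarrow> D y z"
    and "\<And>x y z. \<lbrakk>x \<in> M; y \<in> M; z \<in> M; D y z; D x (p y z)\<rbrakk> \<Longrightarrow> D x y"
    and "Poly_Mapping.keys u \<subseteq> M"
    and "\<And>x r. x \<in> M \<Longrightarrow> pmul D p u (Poly_Mapping.single x r) = Poly_Mapping.single x r"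
    and "\<And>x r. x \<in> M \<Longrightarrow> pmul D p (Poly_Mapping.single x r) u = Poly_Mapping.single x r"
  shows "ring \<lparr>carrier = {a :: 'm \<Rightarrow>\<^sub>0 'k::field. Poly_Mapping.keys a \<subseteq> M},
                mult = pmul D p, one = u, zero = 0, add = (+)\<rparr>"
proof -
  have unit: "pmul D p u a = a" "pmul D p a u = a" if "Poly_Mapping.keys a \<subseteq> M" for a
  proof -
    let ?e = "\<Sum>x\<in>Poly_Mapping.keys a. Poly_Mapping.single x (Poly_Mapping.lookup a x)"
    have "pmul D p u ?e = ?e" "pmul D p ?e u = ?e"
      using that assms(6,7)
      by (auto simp only: pmul_sum_right pmul_sum_left intro!: sum.cong)
    then show "pmul D p u a = a" "pmul D p a u = a"
      by (simp_all only: flip: expand_singles)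
  qed
  show ?thesis
  proof (intro ringI abelian_groupI monoidI; clarsimp simp: add_ac pmul_add_left pmul_add_right unit assms(5))
    show "x \<in> M" if "Poly_Mapping.keys a \<subseteq> M" "Poly_Mapping.keys b \<subseteq> M" "x \<in> Poly_Mapping.keys (a + b)"
      for a b :: "'m \<Rightarrow>\<^sub>0 'k" and x
      using that keys_add[of a b] by blast
    show "\<exists>b. Poly_Mapping.keys b \<subseteq> M \<and> a + b = 0" if "Poly_Mapping.keys a \<subseteq> M" for a :: "'m \<Rightarrow>\<^sub>0 'k"
      using that by (intro exI[of _ "- a"]) (auto simp: in_keys_iff)
    show "x \<in> M" if "Poly_Mapping.keys a \<subseteq> M" "Poly_Mapping.keys b \<subseteq> M" "x \<in> Poly_Mapping.keys (pmul D p a b)" for a b x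
      using keys_pmul[of M D p a b] that assms(1) by blast
    show "pmul D p (pmul D p a b) c = pmul D p a (pmul D p b c)"
      if "Poly_Mapping.keys a \<subseteq> M" "Poly_Mapping.keys b \<subseteq> M" "Poly_Mapping.keys c \<subseteq> M" for a b c
      using that assms(2-4) by (intro pmul_assoc[of M]) blast+
  qed
qed

lemma ring_monoid_algebra:
  assumes "Group.monoid M"
  shows "ring (monoid_algebra M :: ('m \<Rightarrow>\<^sub>0 'k::field) ring)"
proof -
  interpret Group.monoid M by fact
  have *: "monoid_algebra M =
      \<lparr>carrier = {a :: 'm \<Rightarrow>\<^sub>0 'k. Poly_Mapping.keys a \<subseteq> carrier M}, mult = pmul (\<lambda>_ _. True) (\<lambda>x y. x \<otimes>\<^bsub>M\<^esub> y),
       one = Poly_Mapping.single \<one>\<^bsub>M\<^esub> 1, zero = 0, add = (+)\<rparr>"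
    by (simp add: monoid_algebra_def pmul_def fun_eq_iff)
  show ?thesis
    unfolding * by (rule ring_pmul) (auto simp: pmul_single m_assoc)
qed

lemma ring_category_algebra:
  assumes "finite_category C"
  shows "ring (category_algebra C :: ('m \<Rightarrow>\<^sub>0 'k::field) ring)"
proof -
  interpret finite_category C by fact
  let ?D = "\<lambda>g f. Dom C g = Cod C f"
  let ?u = "\<Sum>A\<in>Obj C. Poly_Mapping.single (Ident C A) (1::'k)"
  have *: "category_algebra C =
      \<lparr>carrier = {a :: 'm \<Rightarrow>\<^sub>0 'k. Poly_Mapping.keys a \<subseteq> Mor C}, mult = pmul ?D (Comp C),
       one = ?u, zero = 0, add = (+)\<rparr>"
    by (simp add: category_algebra_def pmul_def fun_eq_iff)
  show ?thesis
    unfolding *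
  proof (rule ring_pmul)
    show "Poly_Mapping.keys ?u \<subseteq> Mor C"
      using keys_sum[of "\<lambda>A. Poly_Mapping.single (Ident C A) (1::'k)" "Obj C"] Ident_in
      by fastforce
    fix x and r :: 'k assume x: "x \<in> Mor C"
    have "pmul ?D (Comp C) ?u (Poly_Mapping.single x r) =
        (\<Sum>A\<in>Obj C. if A = Cod C x then Poly_Mapping.single x r else 0)"
      unfolding pmul_sum_left
      by (intro sum.cong refl) (auto simp: pmul_single Dom_Ident Comp_Ident_left x)
    then show "pmul ?D (Comp C) ?u (Poly_Mapping.single x r) = Poly_Mapping.single x r"
      by (simp add: finite_Obj Cod_in x)
    have "pmul ?D (Comp C) (Poly_Mapping.single x r) ?u =
        (\<Sum>A\<in>Obj C. if A = Dom C x then Poly_Mapping.single x r else 0)"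
      unfolding pmul_sum_right
      by (intro sum.cong refl) (auto simp: pmul_single Cod_Ident Comp_Ident_right x)
    then show "pmul ?D (Comp C) (Poly_Mapping.single x r) ?u = Poly_Mapping.single x r"
      by (simp add: finite_Obj Dom_in x)
  qed (auto simp: Comp_in Dom_Comp Cod_Comp Comp_assoc)
qed

lemma mem_dom_comp: "x \<in> dom (g \<circ>\<^sub>m f) \<Longrightarrow>
    x \<in> dom f \<and> the (f x) \<in> dom g \<and> the ((g \<circ>\<^sub>m f) x) = the (g (the (f x)))"
  by (cases "f x") (auto simp: map_comp_def)

lemma order_preserving_comp:
  assumes "order_preserving f" "order_preserving g"
  shows "order_preserving (g \<circ>\<^sub>m f)"
  unfolding order_preserving_def
proof (rule mono_onI)
  fix x y assume "x \<in> dom (g \<circ>\<^sub>m f)" "y \<in> dom (g \<circ>\<^sub>m f)" "x \<le> y"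
  then show "the ((g \<circ>\<^sub>m f) x) \<le> the ((g \<circ>\<^sub>m f) y)"
    using mem_dom_comp[of x g f] mem_dom_comp[of y g f] assms
    by (metis mono_onD order_preserving_def)
qed

lemma order_decreasing_comp:
  assumes "order_decreasing f" "order_decreasing g"
  shows "order_decreasing (g \<circ>\<^sub>m f)"
  unfolding order_decreasing_def
proof
  fix x assume "x \<in> dom (g \<circ>\<^sub>m f)"
  then show "the ((g \<circ>\<^sub>m f) x) \<le> x"
    using mem_dom_comp[of x g f] assms by (metis order_decreasing_def order_trans)
qed

lemma map_comp_assoc: "(h \<circ>\<^sub>m g) \<circ>\<^sub>m f = h \<circ>\<^sub>m (g \<circ>\<^sub>m f)"
  by (auto simp: map_comp_def fun_eq_iff split: option.splits)

lemma order_restrict_Some: "order_preserving (Some |` A)" "order_decreasing (Some |` A)"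
  by (auto simp: order_preserving_def order_decreasing_def mono_on_def)

lemma ran_restrict_Some: "ran (Some |` A) = A"
  by (auto simp: ran_def restrict_map_def)

lemma dom_comp_subset: "dom (g \<circ>\<^sub>m f) \<subseteq> dom f"
  by (auto simp: map_comp_def split: option.splits)

lemma ran_comp_subset: "ran (g \<circ>\<^sub>m f) \<subseteq> ran g"
  by (auto simp: map_comp_def ran_def split: option.splits)

lemma dom_comp_eq: "dom g = ran f \<Longrightarrow> dom (g \<circ>\<^sub>m f) = dom f"
  by (fastforce simp: map_comp_def ran_def dom_def split: option.splits)

lemma ran_comp_eq: "dom g = ran f \<Longrightarrow> ran (g \<circ>\<^sub>m f) = ran g"
  unfolding map_comp_def ran_def dom_def set_eq_iff mem_Collect_eq
  by (metis option.case(2) option.distinct(1) option.exhaust option.simps(4))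

lemma restrict_Some_comp_left: "ran f \<subseteq> A \<Longrightarrow> (Some |` A) \<circ>\<^sub>m f = f"
  by (auto simp: map_comp_def restrict_map_def fun_eq_iff ran_def split: option.splits)

lemma restrict_Some_comp_right: "dom f \<subseteq> A \<Longrightarrow> f \<circ>\<^sub>m (Some |` A) = f"
proof
  fix x assume "dom f \<subseteq> A"
  then show "(f \<circ>\<^sub>m (Some |` A)) x = f x"
    by (cases "x \<in> A") (auto simp: map_comp_def restrict_map_def dom_def subset_iff,
      metis not_None_eq)
qed

lemma monoid_PC: "Group.monoid (PC n)"
proof (rule Group.monoidI)
  fix f g assume "f \<in> carrier (PC n)" "g \<in> carrier (PC n)"
  then show "f \<otimes>\<^bsub>PC n\<^esub> g \<in> carrier (PC n)"
    using dom_comp_subset[of f g] ran_comp_subset[of f g]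
    by (simp add: PC_def order_preserving_comp order_decreasing_comp) (meson subset_trans)
qed (auto simp: PC_def ran_restrict_Some order_restrict_Some map_comp_assoc
      restrict_Some_comp_left restrict_Some_comp_right)

lemma finite_category_EC: "finite_category (EC n)"
proof
  have "Mor (EC n) \<subseteq> (\<Union>A\<in>Pow {1..n}. {f. dom f = A \<and> ran f \<subseteq> {1..n}})"
    by (auto simp: EC_def EC_hom_def)
  moreover have "finite (\<Union>A\<in>Pow {1..n}. {f. dom f = A \<and> ran f \<subseteq> {1..n}})"
    by (auto intro!: finite_set_of_finite_maps intro: finite_subset)
  ultimately show "finite (Mor (EC n))" by (rule finite_subset)
qed (auto simp: EC_def EC_hom_def dom_comp_eq ran_comp_eq ran_restrict_Some
      order_preserving_comp order_decreasing_comp order_restrict_Some map_comp_assoc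
      restrict_Some_comp_left restrict_Some_comp_right)

end

theory Submission
  imports Defs "HOL-Algebra.QuotRing"
begin

text \<open>
  The defect \<open>\<Sum>x. x - f x\<close> of a morphism of \<open>EC\<close> vanishes only on identities and is
  superadditive under composition. Hence the radical of the category algebra is spanned by the
  nonidentity morphisms, and its \<open>k\<close>-th power is supported on morphisms of defect at least
  \<open>k\<close>. The defect is at most \<open>\<Sum>x\<le>n. x - 1\<close>, which equals \<open>n choose 2\<close>, and this bound is
  attained by lowering, starting from the identity of \<open>{1..n}\<close>, the least value above \<open>1\<close> by one
  at a time. The algebra of \<open>PC\<close> is isomorphic to that of \<open>EC\<close> by sending \<open>f\<close> to the sum of
  all its restrictions.
\<close>

section \<open>Invariance of the Loewy length under isomorphism\<close>

lemma (in ring) ideal_prod_subset_carrier: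
  assumes "I \<subseteq> carrier R" "J \<subseteq> carrier R"
  shows "I \<cdot> J \<subseteq> carrier R"
proof
  fix x assume "x \<in> I \<cdot> J"
  then show "x \<in> carrier R"
    by induction (use assms in auto)
qed

lemma ideals_set_simps [simp]:
  "\<one>\<^bsub>ideals_set R\<^esub> = carrier R"
  "I \<otimes>\<^bsub>ideals_set R\<^esub> J = ideal_prod R I J"
  by (simp_all add: ideals_set_def)

lemma ideals_set_pow_Suc: "I [^]\<^bsub>ideals_set R\<^esub> Suc k = ideal_prod R (I [^]\<^bsub>ideals_set R\<^esub> k) I"
  by simp

lemma (in ring) ideals_set_pow_subset_carrier:
  "I \<subseteq> carrier R \<Longrightarrow> I [^]\<^bsub>ideals_set R\<^esub> (k::nat) \<subseteq> carrier R"
  by (induction k) (simp_all add: ideal_prod_subset_carrier)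

lemma left_ideal_subset: "left_ideal I R \<Longrightarrow> I \<subseteq> carrier R"
  by (simp add: left_ideal_def additive_subgroup.a_subset)

lemma jacobson_radical_subset: "jacobson_radical R \<subseteq> carrier R"
  by (auto simp: jacobson_radical_def)

locale ring_isomorphism = R: ring R + S: ring S
  for R (structure) and S (structure) +
  fixes h
  assumes iso: "h \<in> ring_iso R S"
begin

lemma bij: "bij_betw h (carrier R) (carrier S)"
  using iso by (simp add: ring_iso_def)

lemma hom: "ring_hom_ring R S h"
  using iso by (simp add: ring_hom_ringI2 ring_iso_def R.ring_axioms S.ring_axioms)

lemma image_carrier: "h ` carrier R = carrier S"
  using bij by (simp add: bij_betw_def)

text \<open>Interpreting the locale a second time for the inverse map supplies the converse
  directions in the arguments on maximal left ideals and on the radical.\<close>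

lemma inverse: "ring_isomorphism S R (inv_into (carrier R) h)"
proof
  show "inv_into (carrier R) h \<in> ring_iso S R"
    using ring_iso_set_sym[OF R.ring_axioms iso] .
qed

lemma image_inverse: "I \<subseteq> carrier R \<Longrightarrow> inv_into (carrier R) h ` h ` I = I"
  using bij by (simp add: bij_betw_def inv_into_image_cancel)

lemma inverse_image: "I \<subseteq> carrier S \<Longrightarrow> h ` inv_into (carrier R) h ` I = I"
  by (simp add: image_inv_into_cancel image_carrier)

lemma left_ideal_image:
  assumes "left_ideal I R"
  shows "left_ideal (h ` I) S"
proof -
  interpret h: ring_hom_ring R S h by (rule hom)
  have I: "I \<subseteq> carrier R" using assms by (rule left_ideal_subset)
  have "subgroup (h ` I) (add_monoid S)"
    using assms h.a_group_hom group_hom.subgroup_img_is_subgroup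
    unfolding left_ideal_def additive_subgroup_def by blast
  moreover have "y \<otimes>\<^bsub>S\<^esub> h a \<in> h ` I" if a: "a \<in> I" and y: "y \<in> carrier S" for a y
  proof -
    obtain x where x: "x \<in> carrier R" "y = h x" using y image_carrier by blast
    then have "y \<otimes>\<^bsub>S\<^esub> h a = h (x \<otimes> a)" using subsetD[OF I a] by simp
    then show ?thesis using assms a x by (auto simp: left_ideal_def)
  qed
  ultimately show ?thesis by (auto simp: left_ideal_def additive_subgroup_def)
qed

text \<open>A left ideal \<open>J\<close> above the image is pulled back along the inverse to a left
  ideal above \<open>I\<close>, where maximality decides; pushing forward again recovers
  \<open>J\<close>.\<close>

lemma maximal_left_ideal_image:
  assumes "maximal_left_ideal I R"
  shows "maximal_left_ideal (h ` I) S"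
proof -
  let ?g = "inv_into (carrier R) h"
  interpret g: ring_isomorphism S R ?g by (rule inverse)
  have I: "left_ideal I R" "I \<subseteq> carrier R" "I \<noteq> carrier R"
    using assms left_ideal_subset by (auto simp: maximal_left_ideal_def)
  have "J = h ` I \<or> J = carrier S" if J: "left_ideal J S" "h ` I \<subseteq> J" for J
  proof -
    have JS: "J \<subseteq> carrier S" using J(1) by (rule left_ideal_subset)
    have "I \<subseteq> ?g ` J" using image_mono[OF J(2), of ?g] image_inverse[OF I(2)] by simp
    then have "?g ` J = I \<or> ?g ` J = carrier R"
      using assms g.left_ideal_image[OF J(1)] by (auto simp: maximal_left_ideal_def)
    then have "h ` ?g ` J = h ` I \<or> h ` ?g ` J = h ` carrier R" by metis
    then show ?thesis using inverse_image[OF JS] image_carrier by simp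
  qed
  moreover have "h ` I \<noteq> carrier S"
    using I(2,3) image_inverse[of I] image_inverse[of "carrier R"] image_carrier by auto
  ultimately show ?thesis
    using left_ideal_image[OF I(1)] by (auto simp: maximal_left_ideal_def)
qed

text \<open>Pulling back a maximal left ideal of \<open>S\<close> gives a maximal left ideal of
  \<open>R\<close>, and that one contains every radical element.\<close>

lemma image_jacobson_radical_subset: "h ` jacobson_radical R \<subseteq> jacobson_radical S"
proof -
  let ?g = "inv_into (carrier R) h"
  interpret g: ring_isomorphism S R ?g by (rule inverse)
  have "h x \<in> I" if x: "x \<in> jacobson_radical R" and I: "maximal_left_ideal I S" for x I
  proof -
    have "x \<in> ?g ` I" using x g.maximal_left_ideal_image[OF I] by (auto simp: jacobson_radical_def)
    moreover have "I \<subseteq> carrier S"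
      using I left_ideal_subset by (auto simp: maximal_left_ideal_def)
    ultimately show ?thesis using inverse_image by blast
  qed
  then show ?thesis using image_carrier by (auto simp: jacobson_radical_def)
qed

lemma image_jacobson_radical: "h ` jacobson_radical R = jacobson_radical S"
proof
  let ?g = "inv_into (carrier R) h"
  interpret g: ring_isomorphism S R ?g by (rule inverse)
  have "h ` ?g ` jacobson_radical S \<subseteq> h ` jacobson_radical R"
    using g.image_jacobson_radical_subset by blast
  then show "jacobson_radical S \<subseteq> h ` jacobson_radical R"
    by (simp add: inverse_image jacobson_radical_subset)
qed (rule image_jacobson_radical_subset)

lemma image_ideal_prod:
  assumes "I \<subseteq> carrier R" "J \<subseteq> carrier R"
  shows "h ` ideal_prod R I J = ideal_prod S (h ` I) (h ` J)"
proof -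
  interpret h: ring_hom_ring R S h by (rule hom)
  have "h x \<in> ideal_prod S (h ` I) (h ` J)" if "x \<in> ideal_prod R I J" for x
    using that
  proof induction
    case (prod i j)
    then have "h (i \<otimes> j) = h i \<otimes>\<^bsub>S\<^esub> h j" using assms by (meson h.hom_mult subsetD)
    then show ?case using prod by (auto intro: ideal_prod.prod)
  next
    case (sum x y)
    then have "h (x \<oplus> y) = h x \<oplus>\<^bsub>S\<^esub> h y"
      using R.ideal_prod_subset_carrier[OF assms] by (meson h.hom_add subsetD)
    then show ?case using sum by (auto intro: ideal_prod.sum)
  qed
  moreover have "y \<in> h ` ideal_prod R I J" if "y \<in> ideal_prod S (h ` I) (h ` J)" for y
    using that
  proof induction
    case (prod i j)
    then obtain a b where ab: "a \<in> I" "b \<in> J" "i = h a" "j = h b" by blast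
    then have "h (a \<otimes> b) = i \<otimes>\<^bsub>S\<^esub> j" using assms h.hom_mult by (metis subsetD)
    then show ?case using ideal_prod.prod[OF ab(1,2)] by (metis imageI)
  next
    case (sum x y)
    then obtain a b where ab: "a \<in> ideal_prod R I J" "b \<in> ideal_prod R I J" "x = h a" "y = h b"
      by blast
    then have "h (a \<oplus> b) = x \<oplus>\<^bsub>S\<^esub> y" using R.ideal_prod_subset_carrier[OF assms] h.hom_add by (metis subsetD)
    then show ?case using ideal_prod.sum[OF ab(1,2)] by (metis imageI)
  qed
  ultimately show ?thesis by auto
qed

lemma image_jacobson_radical_pow:
  "h ` (jacobson_radical R [^]\<^bsub>ideals_set R\<^esub> (k::nat)) = jacobson_radical S [^]\<^bsub>ideals_set S\<^esub> k"
proof (induction k)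
  case 0
  then show ?case by (simp add: image_carrier)
next
  case (Suc k)
  then show ?case
    by (simp add: image_ideal_prod image_jacobson_radical
        jacobson_radical_subset R.ideals_set_pow_subset_carrier)
qed

text \<open>The powers of the two radicals correspond under an injective map that preserves zero, so
  they vanish at the same exponents.\<close>

lemma has_loewy_length_iff: "has_loewy_length R m \<longleftrightarrow> has_loewy_length S m"
proof -
  interpret h: ring_hom_ring R S h by (rule hom)
  have "X = {\<zero>} \<longleftrightarrow> h ` X = {\<zero>\<^bsub>S\<^esub>}" if "X \<subseteq> carrier R" for X
  proof
    assume "h ` X = {\<zero>\<^bsub>S\<^esub>}"
    then have "h ` X = h ` {\<zero>}" by simp
    then show "X = {\<zero>}"
      using inj_on_image_eq_iff[of h "carrier R" X "{\<zero>}"] that bij by (simp add: bij_betw_def)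
  qed simp
  then show ?thesis
    using R.ideals_set_pow_subset_carrier[OF jacobson_radical_subset]
    unfolding has_loewy_length_def image_jacobson_radical_pow[symmetric] by simp
qed

end


section \<open>Nilpotent ideals and the radical\<close>

text \<open>Otherwise \<open>L + N\<close> is the whole ring by maximality, so
  \<open>\<one> = l \<oplus> j\<close> with \<open>l\<close> in \<open>L\<close> and
  \<open>j\<close> nilpotent. Descending through the powers of \<open>j\<close>, starting from one
  that is zero, then forces \<open>\<one>\<close> into \<open>L\<close>.\<close>

lemma (in ring) nilpotent_elements_in_maximal_left_ideal:
  assumes N: "ideal N R" and nil: "\<And>x. x \<in> N \<Longrightarrow> \<exists>k::nat. x [^] k = \<zero>"
    and L: "maximal_left_ideal L R"
  shows "N \<subseteq> L"
proof -
  interpret N: ideal N R by (rule N)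
  have left: "left_ideal L R" and "L \<noteq> carrier R" using L by (auto simp: maximal_left_ideal_def)
  then interpret L: additive_subgroup L R by (simp add: left_ideal_def)
  have L_mult: "x \<otimes> a \<in> L" if "x \<in> carrier R" "a \<in> L" for x a
    using left that by (simp add: left_ideal_def)
  have sub: "set_add R L N \<subseteq> carrier R"
    using L.a_subset N.a_subset by (auto simp: set_add_def')
  have "left_ideal (set_add R L N) R"
  proof -
    have "additive_subgroup (set_add R L N) R"
      using add_additive_subgroups[OF L.additive_subgroup_axioms N.additive_subgroup_axioms] .
    moreover have "x \<otimes> a \<in> set_add R L N" if "a \<in> set_add R L N" "x \<in> carrier R" for x a
    proof -
      obtain l j where lj: "l \<in> L" "j \<in> N" "a = l \<oplus> j" using \<open>a \<in> set_add R L N\<close> by (auto simp: set_add_def')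
      then have "x \<otimes> a = x \<otimes> l \<oplus> x \<otimes> j" using \<open>x \<in> carrier R\<close> by (simp add: r_distr)
      then show ?thesis
        using L_mult[OF \<open>x \<in> carrier R\<close> lj(1)] N.I_l_closed[OF lj(2) \<open>x \<in> carrier R\<close>]
        unfolding set_add_def' by blast
    qed
    ultimately show ?thesis by (simp add: left_ideal_def)
  qed
  moreover have "L \<subseteq> set_add R L N"
  proof
    fix l assume "l \<in> L"
    then have "l = l \<oplus> \<zero>" by simp
    then show "l \<in> set_add R L N" using \<open>l \<in> L\<close> N.zero_closed unfolding set_add_def' by blast
  qed
  ultimately consider "set_add R L N = L" | "set_add R L N = carrier R"
    using L by (auto simp: maximal_left_ideal_def)
  then show ?thesis
  proof cases
    case 1
    show ?thesis
    proof
      fix j assume "j \<in> N"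
      then have "j = \<zero> \<oplus> j" by simp
      then have "j \<in> set_add R L N" using \<open>j \<in> N\<close> L.zero_closed unfolding set_add_def' by blast
      then show "j \<in> L" using 1 by simp
    qed
  next
    case 2
    then obtain l j where lj: "l \<in> L" "j \<in> N" "\<one> = l \<oplus> j"
      using one_closed unfolding set_add_def' by blast
    \<comment> \<open>Multiplying \<open>\<one> = l \<oplus> j\<close> on the left by
      \<open>j [^] k\<close> writes this power as a left multiple of \<open>l\<close> plus the next
      power.\<close>
    have step: "j [^] k \<in> L" if "j [^] Suc k \<in> L" for k :: nat
    proof -
      have "j [^] k = j [^] k \<otimes> (l \<oplus> j)" using lj by (simp flip: lj(3))
      also have "\<dots> = j [^] k \<otimes> l \<oplus> j [^] Suc k" using lj by (simp add: r_distr)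
      finally have eq: "j [^] k = j [^] k \<otimes> l \<oplus> j [^] Suc k" .
      have "j [^] k \<otimes> l \<oplus> j [^] Suc k \<in> L"
        using that L_mult[of "j [^] k" l] lj by (intro L.a_closed) auto
      then show ?thesis by (simp only: eq[symmetric])
    qed
    obtain m :: nat where "j [^] m = \<zero>" using nil lj by blast
    then have "j [^] m \<in> L" by simp
    then have "j [^] (0::nat) \<in> L" by (induction m) (use step in auto)
    then have "\<one> \<in> L" by simp
    then have "L = carrier R" using L_mult[of _ \<one>] L.a_subset by auto
    then show ?thesis using \<open>L \<noteq> carrier R\<close> by simp
  qed
qed

text \<open>The recursion for powers appends factors on the right. By associativity a factor may
  also be added on the left, which is how composites of morphisms grow below.\<close>

lemma (in ring) ideal_mult_pow_in_pow:
  assumes I: "ideal I R" and x: "x \<in> I" and y: "y \<in> I [^]\<^bsub>ideals_set R\<^esub> (k::nat)"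
  shows "x \<otimes> y \<in> I [^]\<^bsub>ideals_set R\<^esub> Suc k"
  using y
proof (induction k arbitrary: y)
  case 0
  interpret ideal I R by (rule I)
  \<comment> \<open>The zeroth power is the whole carrier, so the first power is literally
    \<open>ideal_prod R (carrier R) I\<close>; the factor \<open>\<one>\<close> brings
    \<open>x \<otimes> y\<close> into that shape.\<close>
  have "\<one> \<otimes> (x \<otimes> y) \<in> ideal_prod R (carrier R) I"
    using 0 x by (intro ideal_prod.prod) (auto simp: I_r_closed)
  then show ?case using 0 x by (simp add: ideals_set_pow_Suc)
next
  case (Suc k)
  interpret ideal I R by (rule I)
  let ?P = "I [^]\<^bsub>ideals_set R\<^esub> k"
  have P: "?P \<subseteq> carrier R" by (rule ideals_set_pow_subset_carrier) (rule a_subset)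
  have "y \<in> ideal_prod R ?P I" using Suc.prems by (simp add: ideals_set_pow_Suc)
  then show ?case
  proof induction
    case (prod i j)
    then have "x \<otimes> (i \<otimes> j) = (x \<otimes> i) \<otimes> j" using P x by (auto simp: m_assoc)
    then show ?case
      using Suc.IH[OF prod(1)] prod(2) ideals_set_pow_Suc[where R=R and I=I and k="Suc k"] by (metis ideal_prod.prod)
  next
    case (sum s t)
    then have "x \<otimes> (s \<oplus> t) = x \<otimes> s \<oplus> x \<otimes> t"
      using ideal_prod_subset_carrier[OF P a_subset] x by (meson Icarr r_distr subsetD)
    then show ?case using sum(3,4) ideals_set_pow_Suc[where R=R and I=I and k="Suc k"] by (metis ideal_prod.sum)
  qed
qed


section \<open>Categories graded by a superadditive defect\<close>

text \<open>Abstracts \<open>EC\<close> with its defect. Modulo the span of the morphisms of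
  positive defect, the algebra is a product of copies of the field, one for each object.\<close>

locale graded_category = finite_category C for C :: "('o, 'm) category" +
  fixes d :: "'m \<Rightarrow> nat"
  assumes defect_Comp: "f \<in> Mor C \<Longrightarrow> g \<in> Mor C \<Longrightarrow> Dom C g = Cod C f \<Longrightarrow>
      d g + d f \<le> d (Comp C g f)"
    and defect_eq_0: "f \<in> Mor C \<Longrightarrow> d f = 0 \<Longrightarrow> f \<in> Ident C ` Obj C"
begin

text \<open>A descending filtration by two-sided ideals: \<open>filt 0\<close> is the whole algebra,
  and \<open>filt 1\<close> turns out to be its radical.\<close>

definition filt :: "nat \<Rightarrow> ('m \<Rightarrow>\<^sub>0 'k::field) set" where
  "filt k = {a. Poly_Mapping.keys a \<subseteq> {f \<in> Mor C. k \<le> d f}}"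

text \<open>An identity composed with itself is itself, so superadditivity bounds twice its defect
  by its defect.\<close>

lemma defect_Ident: "A \<in> Obj C \<Longrightarrow> d (Ident C A) = 0"
  using defect_Comp[of "Ident C A" "Ident C A"] Comp_Ident_left[of "Ident C A"]
  by (simp add: Ident_in Dom_Ident Cod_Ident)

lemma category_algebra_simps:
  "carrier (category_algebra C) = filt 0"
  "x \<otimes>\<^bsub>category_algebra C\<^esub> y = pmul (\<lambda>g f. Dom C g = Cod C f) (Comp C) x y"
  "x \<oplus>\<^bsub>category_algebra C\<^esub> y = x + y"
  "\<zero>\<^bsub>category_algebra C\<^esub> = 0"
  by (auto simp: category_algebra_def pmul_def filt_def)

section \<open>The filtration by defect\<close>

lemma filt_mono: "k \<le> l \<Longrightarrow> filt l \<subseteq> filt k"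
  by (force simp: filt_def)

lemma zero_in_filt: "0 \<in> filt k"
  by (simp add: filt_def)

lemma add_in_filt: "a \<in> filt k \<Longrightarrow> b \<in> filt k \<Longrightarrow> a + b \<in> filt k"
  using keys_add[of a b] by (auto simp: filt_def)

lemma uminus_in_filt: "a \<in> filt k \<Longrightarrow> - a \<in> filt k"
  by (simp add: filt_def keys_def)

lemma sum_in_filt: "(\<And>i. i \<in> S \<Longrightarrow> F i \<in> filt k) \<Longrightarrow> sum F S \<in> filt k"
  by (induction S rule: infinite_finite_induct) (auto simp: zero_in_filt add_in_filt)

lemma mult_in_filt:
  assumes "a \<in> filt k" "b \<in> filt l"
  shows "pmul (\<lambda>g f. Dom C g = Cod C f) (Comp C) a b \<in> filt (k + l)"
  unfolding pmul_def
proof (intro sum_in_filt)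
  fix g f assume "g \<in> Poly_Mapping.keys a" "f \<in> Poly_Mapping.keys b"
  then have gf: "g \<in> Mor C" "f \<in> Mor C" "k \<le> d g" "l \<le> d f"
    using assms by (auto simp: filt_def)
  show "(if Dom C g = Cod C f then Poly_Mapping.single (Comp C g f)
      (Poly_Mapping.lookup a g * Poly_Mapping.lookup b f) else 0) \<in> filt (k + l)"
    using gf defect_Comp[of f g] by (auto simp: filt_def Comp_in)
qed

lemma ring: "ring (category_algebra C :: ('m \<Rightarrow>\<^sub>0 'k::field) ring)"
  by (rule ring_category_algebra) (rule finite_category_axioms)

lemma additive_subgroupI:
  assumes "H \<subseteq> filt 0" "0 \<in> H" "\<And>a b. a \<in> H \<Longrightarrow> b \<in> H \<Longrightarrow> a + b \<in> H"
    and "\<And>a. a \<in> H \<Longrightarrow> - a \<in> H"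
  shows "additive_subgroup H (category_algebra C :: ('m \<Rightarrow>\<^sub>0 'k::field) ring)" (is "additive_subgroup _ ?R")
  unfolding additive_subgroup_def
proof (rule subgroup.intro)
  interpret ring ?R by (rule ring)
  fix a assume a: "a \<in> H"
  then have "\<ominus>\<^bsub>?R\<^esub> a = - a"
    using assms(1) by (intro minus_equality) (auto simp: category_algebra_simps uminus_in_filt)
  then show "inv\<^bsub>add_monoid ?R\<^esub> a \<in> H" using assms(4)[OF a] by (simp add: a_inv_def)
qed (use assms in \<open>simp_all add: category_algebra_simps\<close>)

lemma filt_additive_subgroup: "additive_subgroup (filt k) (category_algebra C :: ('m \<Rightarrow>\<^sub>0 'k::field) ring)"
  by (intro additive_subgroupI filt_mono) (simp_all add: zero_in_filt add_in_filt uminus_in_filt)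

lemma filt_ideal: "ideal (filt k) (category_algebra C :: ('m \<Rightarrow>\<^sub>0 'k::field) ring)"
  using filt_additive_subgroup[of k] ring mult_in_filt[of _ 0 _ k] mult_in_filt[of _ k _ 0]
  by (intro idealI) (auto simp: additive_subgroup_def category_algebra_simps)

lemma filt_eq_zero:
  assumes "\<And>f. f \<in> Mor C \<Longrightarrow> d f < k"
  shows "filt k = {0}"
proof -
  have "{f \<in> Mor C. k \<le> d f} = {}" using assms by (force simp: not_less)
  then have "filt k = {a. Poly_Mapping.keys a \<subseteq> {}}" unfolding filt_def by (simp only:)
  then show ?thesis by (simp add: Collect_conv_if)
qed

text \<open>Finitely many morphisms have bounded defect. Together with multiplicativity of the
  filtration this makes the elements of \<open>filt 1\<close> nilpotent.\<close>

lemma ex_filt_eq_zero: "\<exists>k. filt k = {0}"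
proof
  show "filt (Suc (Max (d ` Mor C))) = {0}"
    by (rule filt_eq_zero) (simp add: finite_Mor less_Suc_eq_le)
qed

text \<open>An identity factors only as itself composed with itself: both factors must have defect
  0, hence are identities, and composability makes them equal. So taking its coefficient is
  multiplicative.\<close>

lemma lookup_Ident_mult:
  assumes A: "A \<in> Obj C" and "a \<in> filt 0" "b \<in> filt 0"
  shows "Poly_Mapping.lookup (pmul (\<lambda>g f. Dom C g = Cod C f) (Comp C) a b) (Ident C A) =
    Poly_Mapping.lookup a (Ident C A) * Poly_Mapping.lookup b (Ident C A)"
proof -
  let ?D = "\<lambda>g f. Dom C g = Cod C f" and ?I = "Ident C A"
  have Comp_eq: "Comp C g f = ?I \<longleftrightarrow> g = ?I \<and> f = ?I"
    if gf: "g \<in> Mor C" "f \<in> Mor C" "Dom C g = Cod C f" for g f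
  proof
    assume eq: "Comp C g f = ?I"
    then have "d g = 0" "d f = 0" using defect_Comp[of f g] gf defect_Ident[OF A] by auto
    then obtain B E where "g = Ident C B" "f = Ident C E" "B \<in> Obj C" "E \<in> Obj C"
      using defect_eq_0 gf by blast
    moreover from this have "B = E" using gf by (simp add: Dom_Ident Cod_Ident)
    ultimately show "g = ?I \<and> f = ?I"
      using eq gf Comp_Ident_left[of f] by (simp add: Cod_Ident)
  next
    assume "g = ?I \<and> f = ?I"
    then show "Comp C g f = ?I"
      using Comp_Ident_left[of ?I] by (simp add: Ident_in Cod_Ident A)
  qed
  have keys: "Poly_Mapping.keys a \<subseteq> Mor C" "Poly_Mapping.keys b \<subseteq> Mor C"
    using assms by (auto simp: filt_def)
  have *: "Poly_Mapping.lookup (if ?D g f then Poly_Mapping.single (Comp C g f)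
      (Poly_Mapping.lookup a g * Poly_Mapping.lookup b f) else 0) ?I =
      (if f = ?I then if g = ?I then Poly_Mapping.lookup a g * Poly_Mapping.lookup b f else 0 else 0)"
    if "g \<in> Mor C" "f \<in> Mor C" for g f
  proof (cases "?D g f")
    case True
    then show ?thesis using Comp_eq[OF that True] by (simp add: lookup_single when_def)
  next
    case False
    \<comment> \<open>The two factors cannot both be \<open>?I\<close>, since those are composable;
      hence the nested conditional is 0 as well.\<close>
    moreover have "?D ?I ?I" by (simp add: Dom_Ident Cod_Ident A)
    ultimately show ?thesis by auto
  qed
  have "Poly_Mapping.lookup (pmul ?D (Comp C) a b) ?I = (\<Sum>g\<in>Mor C. \<Sum>f\<in>Mor C.
      if f = ?I then if g = ?I then Poly_Mapping.lookup a g * Poly_Mapping.lookup b f else 0 else 0)"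
    by (simp only: pmul_superset[OF finite_Mor finite_Mor keys] lookup_sum)
      (intro sum.cong refl *)
  then show ?thesis by (simp add: finite_Mor Ident_in A)
qed

lemma one_in_filt: "(\<Sum>A\<in>Obj C. Poly_Mapping.single (Ident C A) (1::'k::field)) \<in> filt 0"
  by (intro sum_in_filt) (auto simp: filt_def Ident_in)

text \<open>This is the kernel of a multiplicative coefficient map onto the field.\<close>

lemma maximal_left_ideal_Ident:
  assumes A: "A \<in> Obj C"
  shows "maximal_left_ideal {a \<in> filt 0. Poly_Mapping.lookup a (Ident C A) = 0}
    (category_algebra C :: ('m \<Rightarrow>\<^sub>0 'k::field) ring)"
    (is "maximal_left_ideal ?M ?R")
proof -
  interpret ring ?R by (rule ring)
  let ?I = "Ident C A"
  have single: "Poly_Mapping.single ?I c \<in> filt 0" for c :: 'k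
    using Ident_in A by (auto simp: filt_def)
  have "left_ideal ?M ?R"
    unfolding left_ideal_def
  proof (intro conjI ballI)
    show "additive_subgroup ?M ?R"
      by (rule additive_subgroupI) (auto simp: zero_in_filt add_in_filt uminus_in_filt lookup_add)
  qed (use mult_in_filt[of _ 0 _ 0] in \<open>auto simp: category_algebra_simps lookup_Ident_mult A\<close>)
  moreover have "?M \<noteq> carrier ?R"
  proof -
    have "Poly_Mapping.single ?I (1::'k) \<in> carrier ?R - ?M" using single by (simp add: category_algebra_simps)
    then show ?thesis by blast
  qed
  moreover have "J = ?M \<or> J = carrier ?R" if J: "left_ideal J ?R" "?M \<subseteq> J" for J
  proof (cases "J \<subseteq> ?M")
    case False
    have sub: "J \<subseteq> filt 0" using left_ideal_subset[OF J(1)] by (simp add: category_algebra_simps)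
    then obtain b where b: "b \<in> J" "b \<in> filt 0" "Poly_Mapping.lookup b ?I \<noteq> 0" using False by blast
    interpret J: additive_subgroup J ?R using J(1) by (simp add: left_ideal_def)
    have J_mult: "pmul (\<lambda>g f. Dom C g = Cod C f) (Comp C) x a \<in> J" if "x \<in> filt 0" "a \<in> J" for x a
      using J(1) that by (simp add: left_ideal_def category_algebra_simps)
    have "x \<in> J" if x: "x \<in> filt 0" for x
    proof -
      \<comment> \<open>A left multiple of \<open>b\<close>, scaled to agree with \<open>x\<close>
        at the identity, so that \<open>x\<close> differs from an element of \<open>J\<close> by an
        element of the kernel.\<close>
      define y where "y = pmul (\<lambda>g f. Dom C g = Cod C f) (Comp C)
        (Poly_Mapping.single ?I (Poly_Mapping.lookup x ?I / Poly_Mapping.lookup b ?I)) b"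
      have y: "y \<in> J" "y \<in> filt 0" using J_mult single b(1) sub by (auto simp: y_def)
      have "Poly_Mapping.lookup y ?I = Poly_Mapping.lookup x ?I"
        using b by (simp add: y_def lookup_Ident_mult[OF A single])
      then have "x + (- y) \<in> ?M" 
        using add_in_filt[OF x uminus_in_filt[OF y(2)]] by (simp add: lookup_minus)
      then have "(x + (- y)) \<oplus>\<^bsub>?R\<^esub> y \<in> J" using J(2) y J.a_closed by blast
      then show ?thesis by (simp add: category_algebra_simps)
    qed
    then show ?thesis using sub by (auto simp: category_algebra_simps)
  qed (use J in blast)
  ultimately show ?thesis unfolding maximal_left_ideal_def by blast
qed

lemma nat_pow_in_filt:
  assumes "a \<in> filt 1"
  shows "a [^]\<^bsub>category_algebra C\<^esub> k \<in> filt k"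
proof (induction k)
  case 0
  show ?case using one_in_filt by (simp add: nat_pow_def category_algebra_def)
next
  case (Suc k)
  then show ?case using mult_in_filt[OF Suc assms] by (simp add: nat_pow_def category_algebra_simps)
qed

text \<open>The ideal \<open>filt 1\<close> consists of nilpotent elements and so lies in every
  maximal left ideal. Conversely, the maximal left ideals attached to the objects kill all
  coefficients at identities, leaving only morphisms of positive defect.\<close>

theorem jacobson_radical_eq:
  "jacobson_radical (category_algebra C :: ('m \<Rightarrow>\<^sub>0 'k::field) ring) = filt 1"
  (is "jacobson_radical ?R = _")
proof
  interpret ring ?R by (rule ring)
  have "\<exists>k::nat. x [^]\<^bsub>?R\<^esub> k = \<zero>\<^bsub>?R\<^esub>" if "x \<in> filt 1" for x
    using nat_pow_in_filt[OF that] ex_filt_eq_zero by (metis category_algebra_simps(4) singletonD)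
  then have "filt 1 \<subseteq> L" if "maximal_left_ideal L ?R" for L
    using nilpotent_elements_in_maximal_left_ideal filt_ideal that by blast
  then show "filt 1 \<subseteq> jacobson_radical ?R"
    using filt_mono[of 0 1] by (auto simp: jacobson_radical_def category_algebra_simps)
  show "jacobson_radical ?R \<subseteq> filt 1"
  proof
    fix a assume a: "a \<in> jacobson_radical ?R"
    then have a0: "a \<in> filt 0" using subsetD[OF jacobson_radical_subset a] by (simp add: category_algebra_simps)
    have "Poly_Mapping.lookup a (Ident C A) = 0" if "A \<in> Obj C" for A
      using a maximal_left_ideal_Ident[OF that] by (auto simp: jacobson_radical_def)
    then have "d f \<noteq> 0" if "f \<in> Poly_Mapping.keys a" for f
      using defect_eq_0[of f] that a0 by (force simp: filt_def in_keys_iff)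
    then show "a \<in> filt 1" using a0 by (fastforce simp: filt_def)
  qed
qed

text \<open>Each factor from the radical raises the filtration degree by at least one; this yields
  the upper bound on the Loewy length.\<close>

lemma radical_pow_subset:
  "jacobson_radical (category_algebra C :: ('m \<Rightarrow>\<^sub>0 'k::field) ring)
    [^]\<^bsub>ideals_set (category_algebra C :: ('m \<Rightarrow>\<^sub>0 'k::field) ring)\<^esub> k \<subseteq> filt k"
  (is "?J [^]\<^bsub>ideals_set ?R\<^esub> k \<subseteq> _")
proof (induction k)
  case 0
  then show ?case by (simp add: category_algebra_simps)
next
  case (Suc k)
  show ?case
  proof
    fix x assume "x \<in> ?J [^]\<^bsub>ideals_set ?R\<^esub> Suc k"
    then have "x \<in> ideal_prod ?R (?J [^]\<^bsub>ideals_set ?R\<^esub> k) ?J" by (simp add: ideals_set_pow_Suc)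
    then show "x \<in> filt (Suc k)"
    proof induction
      case (prod i j)
      then show ?case
        using Suc mult_in_filt[of i k j 1] by (auto simp: category_algebra_simps jacobson_radical_eq)
    qed (simp add: category_algebra_simps add_in_filt)
  qed
qed

text \<open>Serves the lower bound: a composable product of basis elements is again a basis element,
  so chains of nonidentity morphisms give nonzero elements of the powers.\<close>

lemma single_Comp_in_radical_pow:
  assumes "Poly_Mapping.single f (1::'k::field) \<in>
      jacobson_radical (category_algebra C) [^]\<^bsub>ideals_set (category_algebra C)\<^esub> k"
    and "g \<in> Mor C" "d g \<noteq> 0" "Dom C g = Cod C f"
  shows "Poly_Mapping.single (Comp C g f) (1::'k) \<in>
      jacobson_radical (category_algebra C) [^]\<^bsub>ideals_set (category_algebra C)\<^esub> Suc k"
proof -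
  interpret ring "category_algebra C :: ('m \<Rightarrow>\<^sub>0 'k) ring" by (rule ring)
  have "Poly_Mapping.single g (1::'k) \<in> filt 1" using assms(2,3) by (auto simp: filt_def)
  from ideal_mult_pow_in_pow[OF filt_ideal this assms(1)[unfolded jacobson_radical_eq]]
  show ?thesis by (simp add: jacobson_radical_eq category_algebra_simps pmul_single assms(4))
qed

lemma has_loewy_lengthI:
  assumes "\<And>f. f \<in> Mor C \<Longrightarrow> d f \<le> N"
    and "\<And>k. k \<le> N \<Longrightarrow> \<exists>f. Poly_Mapping.single f (1::'k::field) \<in>
      jacobson_radical (category_algebra C) [^]\<^bsub>ideals_set (category_algebra C)\<^esub> k"
  shows "has_loewy_length (category_algebra C :: ('m \<Rightarrow>\<^sub>0 'k) ring) (N + 1)"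
  (is "has_loewy_length ?R _")
proof -
  interpret ring ?R by (rule ring)
  let ?P = "\<lambda>k. jacobson_radical ?R [^]\<^bsub>ideals_set ?R\<^esub> k"
  \<comment> \<open>Vanishing of a power means equality with the zero set, so an inclusion alone
    would not suffice.\<close>
  have "\<zero>\<^bsub>?R\<^esub> \<in> ?P k" for k :: nat
  proof (induction k)
    case 0
    show ?case by simp
  next
    case (Suc k)
    have "\<zero>\<^bsub>?R\<^esub> \<in> jacobson_radical ?R" by (simp add: jacobson_radical_eq category_algebra_simps zero_in_filt)
    then have "\<zero>\<^bsub>?R\<^esub> \<otimes>\<^bsub>?R\<^esub> \<zero>\<^bsub>?R\<^esub> \<in> ?P (Suc k)"
      unfolding ideals_set_pow_Suc using Suc by (intro ideal_prod.prod)
    then show ?case by simp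
  qed
  moreover have "?P (N + 1) \<subseteq> {\<zero>\<^bsub>?R\<^esub>}"
    using radical_pow_subset[of "N + 1"] filt_eq_zero[of "N + 1"] assms(1)
    by (force simp: category_algebra_simps less_Suc_eq_le)
  moreover have "?P k \<noteq> {\<zero>\<^bsub>?R\<^esub>}" if "k < N + 1" for k
  proof
    assume "?P k = {\<zero>\<^bsub>?R\<^esub>}"
    moreover have "k \<le> N" using that by simp
    then obtain f where "Poly_Mapping.single f (1::'k) \<in> ?P k" using assms(2) by blast
    ultimately have "Poly_Mapping.single f (1::'k) = 0" by (simp add: category_algebra_simps)
    then show False by (metis lookup_single_eq lookup_zero zero_neq_one)
  qed
  ultimately show ?thesis unfolding has_loewy_length_def by blast
qed

end


section \<open>The Loewy length of the algebra of \<open>EC\<close>\<close>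

text \<open>Truncated subtraction loses nothing on order-decreasing maps.\<close>

definition defect :: "(nat \<rightharpoonup> nat) \<Rightarrow> nat" where
  "defect f = (\<Sum>x\<in>dom f. x - the (f x))"

lemma mem_Mor_EC: "f \<in> Mor (EC n) \<longleftrightarrow>
    dom f \<subseteq> {1..n} \<and> ran f \<subseteq> {1..n} \<and> order_preserving f \<and> order_decreasing f"
  by (auto simp: EC_def EC_hom_def)

lemma EC_simps:
  "Obj (EC n) = Pow {1..n}" "Dom (EC n) = dom" "Cod (EC n) = ran"
  "Ident (EC n) A = Some |` A" "Comp (EC n) = (\<lambda>g f. g \<circ>\<^sub>m f)"
  by (auto simp: EC_def)

lemma ran_eq_image: "ran f = (\<lambda>x. the (f x)) ` dom f"
  by (force simp: ran_def dom_def image_def)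

text \<open>The descent from \<open>x\<close> to its final value splits at \<open>f x\<close>. The
  first sum runs over \<open>dom f\<close>, so it counts the descent of \<open>g\<close> at a value
  once for each of its preimages.\<close>

lemma defect_comp:
  assumes "finite (dom f)" "order_decreasing f" "order_decreasing g" "dom g = ran f"
  shows "defect (g \<circ>\<^sub>m f) = (\<Sum>x\<in>dom f. the (f x) - the (g (the (f x)))) + defect f"
proof -
  have dom: "dom (g \<circ>\<^sub>m f) = dom f" using assms(4) by (rule dom_comp_eq)
  have "x - the ((g \<circ>\<^sub>m f) x) = (the (f x) - the (g (the (f x)))) + (x - the (f x))"
    if "x \<in> dom f" for x
    using mem_dom_comp[of x g f] that assms(2,3) unfolding dom order_decreasing_def
    by (metis add.commute le_add_diff_inverse Nat.diff_add_assoc2 add_diff_assoc2)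
  then show ?thesis unfolding defect_def dom by (simp flip: sum.distrib)
qed

lemma graded_category_EC: "graded_category (EC n) defect"
proof (intro graded_category.intro finite_category_EC graded_category_axioms.intro)
  fix f g assume f: "f \<in> Mor (EC n)" and g: "g \<in> Mor (EC n)" and "Dom (EC n) g = Cod (EC n) f"
  then have gf: "dom g = ran f" by (simp add: EC_simps)
  have fin: "finite (dom f)" using f finite_subset[of "dom f" "{1..n}"] by (simp add: mem_Mor_EC)
  \<comment> \<open>Every point of \<open>dom g\<close> is a value of \<open>f\<close>, and passing
    to preimages can only repeat summands.\<close>
  have "defect g \<le> (\<Sum>x\<in>dom f. the (f x) - the (g (the (f x))))"
    unfolding defect_def gf unfolding ran_eq_image[of f]
    using sum_image_le[OF fin, of "\<lambda>y. y - the (g y)" "\<lambda>x. the (f x)"] by (simp add: comp_def)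
  then show "defect g + defect f \<le> defect (Comp (EC n) g f)"
    using defect_comp[OF fin _ _ gf] f g by (simp add: EC_simps mem_Mor_EC)
next
  fix f assume f: "f \<in> Mor (EC n)" and 0: "defect f = 0"
  have fin: "finite (dom f)" using f finite_subset[of "dom f" "{1..n}"] by (simp add: mem_Mor_EC)
  have "the (f x) = x" if "x \<in> dom f" for x
  proof -
    have "x - the (f x) = 0" using 0 fin that unfolding defect_def by simp
    moreover have "the (f x) \<le> x" using f that by (simp add: mem_Mor_EC order_decreasing_def)
    ultimately show ?thesis by simp
  qed
  then have "f = Some |` dom f" by (fastforce simp: restrict_map_def fun_eq_iff)
  then show "f \<in> Ident (EC n) ` Obj (EC n)"
    using f unfolding mem_Mor_EC EC_simps image_def by blast
qed

interpretation EC: graded_category "EC n" defect for n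
  by (rule graded_category_EC)

lemma sum_pred_eq_choose_two: "(\<Sum>x=1..n. x - 1) = n choose 2"
  by (induction n) (auto simp: numeral_2_eq_2)

text \<open>All values are at least 1, so a point \<open>x\<close> descends by at most
  \<open>x - 1\<close>.\<close>

lemma defect_le:
  assumes "f \<in> Mor (EC n)"
  shows "defect f \<le> n choose 2"
proof -
  have "the (f x) \<ge> 1" if "x \<in> dom f" for x
    using assms that by (force simp: mem_Mor_EC ran_def)
  then have "defect f \<le> (\<Sum>x\<in>dom f. x - 1)"
    unfolding defect_def by (intro sum_mono diff_le_mono2) auto
  also have "\<dots> \<le> (\<Sum>x=1..n. x - 1)"
    using assms by (intro sum_mono2) (auto simp: mem_Mor_EC)
  finally show ?thesis by (simp only: sum_pred_eq_choose_two)
qed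

text \<open>
  Injectivity above the value \<open>1\<close> is what makes lowering a single value raise the defect by
  exactly one.
\<close>

lemma ex_longer_chain:
  assumes f: "f \<in> Mor (EC n)" "dom f = {1..n}" "defect f < n choose 2"
    and inj: "inj_on (\<lambda>x. the (f x)) {x \<in> dom f. the (f x) > 1}"
  obtains g where "g \<in> Mor (EC n)" "defect g \<noteq> 0" "dom g = ran f" "g \<circ>\<^sub>m f \<in> Mor (EC n)"
    "defect (g \<circ>\<^sub>m f) = Suc (defect f)"
    "inj_on (\<lambda>x. the ((g \<circ>\<^sub>m f) x)) {x \<in> dom f. the ((g \<circ>\<^sub>m f) x) > 1}"
proof -
  define Y where "Y = {y \<in> ran f. y > 1}"
  have ran: "ran f \<subseteq> {1..n}" using f by (simp add: mem_Mor_EC)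
  then have finY: "finite Y" using finite_subset[of "ran f" "{1..n}"] by (simp add: Y_def)
  \<comment> \<open>Without a value above 1 the map would be constantly 1 on \<open>{1..n}\<close>
    and already have the maximal defect.\<close>
  have "Y \<noteq> {}"
  proof
    assume "Y = {}"
    then have "the (f x) = 1" if "x \<in> dom f" for x
      using that ran by (fastforce simp: Y_def ran_def)
    then have "defect f = (\<Sum>x=1..n. x - 1)" unfolding defect_def f(2)[symmetric] by simp
    then show False using f(3) by (simp only: sum_pred_eq_choose_two)
  qed
  \<comment> \<open>Minimality leaves only 1 as a possible value below \<open>y\<close>, so
    replacing \<open>y\<close> by \<open>y - 1\<close> keeps the order and stays at least 1.\<close>
  define y where "y = Min Y"
  have y: "y \<in> ran f" "y > 1" using Min_in[OF finY \<open>Y \<noteq> {}\<close>] by (auto simp: Y_def y_def)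
  have y_le: "y \<le> z" if "z \<in> ran f" "z > 1" for z
    using Min_le[OF finY, of z] that by (simp add: Y_def y_def)
  obtain a where a: "a \<in> dom f" "the (f a) = y" using y(1) by (auto simp: ran_eq_image)
  \<comment> \<open>Only one point is moved by lowering \<open>y\<close>, so exactly one summand of
    the defect grows, and it grows by 1.\<close>
  have uniq: "x = a" if "x \<in> dom f" "the (f x) = y" for x
    using inj_onD[OF inj, of x a] that a y(2) by simp
  define g where "g = (\<lambda>z. if z = y then y - 1 else z)"
  define G where "G = (\<lambda>z. Some (g z)) |` ran f"
  have domG: "dom G = ran f" by (auto simp: G_def restrict_map_def split: if_splits)
  have G: "the (G z) = g z" if "z \<in> ran f" for z using that by (simp add: G_def)
  have ranG: "ran G \<subseteq> {1..n}"
    unfolding ran_eq_image[of G] domG using ran y by (force simp: G g_def)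
  have "order_preserving G"
    unfolding order_preserving_def domG
  proof (rule mono_onI)
    fix u v assume "u \<in> ran f" "v \<in> ran f" "u \<le> v"
    then show "the (G u) \<le> the (G v)"
      using y_le[of u] y_le[of v] y(2) by (auto simp: G g_def)
  qed
  moreover have decG: "order_decreasing G"
    unfolding order_decreasing_def domG by (auto simp: G g_def)
  ultimately have MorG: "G \<in> Mor (EC n)" using ran ranG domG by (simp add: mem_Mor_EC)
  have "the (G y) \<noteq> y" using G[OF y(1)] y(2) by (simp add: g_def)
  then have "G \<noteq> Ident (EC n) (dom G)" using y(1) domG by (auto simp: EC_simps)
  then have "defect G \<noteq> 0"
    using EC.defect_eq_0[OF MorG] by (force simp: EC_simps)
  have fin: "finite (dom f)" using f(2) by simp
  have mem: "the (f x) \<in> ran f" if "x \<in> dom f" for x using that by (auto simp: ran_eq_image)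
  have "(\<Sum>x\<in>dom f. the (f x) - the (G (the (f x)))) = (\<Sum>x\<in>dom f. if x = a then 1 else 0)"
  proof (intro sum.cong refl)
    fix x assume "x \<in> dom f"
    then have "the (G (the (f x))) = (if x = a then y - 1 else the (f x))"
      using uniq[of x] a(2) G[OF mem[of x]] unfolding g_def by metis
    then show "the (f x) - the (G (the (f x))) = (if x = a then 1 else 0)"
      using a(2) y(2) by (simp split: if_split)
  qed
  then have "defect (G \<circ>\<^sub>m f) = Suc (defect f)"
    using defect_comp[OF fin _ decG domG] f(1) fin a by (simp add: mem_Mor_EC)
  moreover have "inj_on (\<lambda>x. the ((G \<circ>\<^sub>m f) x)) {x \<in> dom f. the ((G \<circ>\<^sub>m f) x) > 1}"
  proof (rule inj_onI; clarify)
    fix u v u' v'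
    assume u: "f u = Some u'" "1 < the ((G \<circ>\<^sub>m f) u)" and v: "f v = Some v'" "1 < the ((G \<circ>\<^sub>m f) v)"
      and eq: "the ((G \<circ>\<^sub>m f) u) = the ((G \<circ>\<^sub>m f) v)"
    have uv: "u' \<in> ran f" "v' \<in> ran f" "u \<in> dom f" "v \<in> dom f" using u v by (auto intro: ranI)
    have "g u' > 1" "g v' > 1" "g u' = g v'"
      using u v eq uv G by (auto simp: map_comp_def)
    \<comment> \<open>A new collision above 1 would need \<open>y - 1\<close> to be a value of
      \<open>f\<close> above 1, against the minimality of \<open>y\<close>.\<close>
    then have "u' = v'" "u' > 1"
      using y_le[OF uv(1)] y_le[OF uv(2)] y(2) by (auto simp: g_def split: if_splits)
    then show "u = v" using inj_onD[OF inj, of u v] u v uv by simp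
  qed
  moreover have "G \<circ>\<^sub>m f \<in> Mor (EC n)"
    using EC.Comp_in[OF f(1) MorG] domG by (simp add: EC_simps)
  ultimately show ?thesis using that MorG \<open>defect G \<noteq> 0\<close> domG by blast
qed

text \<open>Full domain, exact defect and injectivity above 1 are carried through the induction so
  that \<open>ex_longer_chain\<close> applies again at each step.\<close>

lemma ex_chain:
  assumes "k \<le> n choose 2"
  shows "\<exists>f \<in> Mor (EC n). dom f = {1..n} \<and> defect f = k \<and>
    inj_on (\<lambda>x. the (f x)) {x \<in> dom f. the (f x) > 1} \<and>
    Poly_Mapping.single f (1::'k::field) \<in>
      jacobson_radical (category_algebra (EC n)) [^]\<^bsub>ideals_set (category_algebra (EC n))\<^esub> k"
  using assms
proof (induction k)
  case 0
  let ?f = "Some |` {1..n}"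
  have Mor: "?f \<in> Mor (EC n)" by (simp add: mem_Mor_EC order_restrict_Some ran_restrict_Some)
  moreover have "defect ?f = 0" by (simp add: defect_def)
  moreover have "Poly_Mapping.single ?f (1::'k) \<in> EC.filt n 0"
    using Mor by (simp add: EC.filt_def)
  ultimately show ?case
    by (intro bexI[of _ ?f]) (auto simp: EC.category_algebra_simps inj_on_def)
next
  case (Suc k)
  then obtain f where f: "f \<in> Mor (EC n)" "dom f = {1..n}" "defect f = k"
      "inj_on (\<lambda>x. the (f x)) {x \<in> dom f. the (f x) > 1}"
      "Poly_Mapping.single f (1::'k) \<in>
        jacobson_radical (category_algebra (EC n)) [^]\<^bsub>ideals_set (category_algebra (EC n))\<^esub> k"
    by auto
  from f Suc.prems have "defect f < n choose 2" by simp
  from ex_longer_chain[OF f(1,2) this f(4)] obtain g where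
    g: "g \<in> Mor (EC n)" "defect g \<noteq> 0" "dom g = ran f" "g \<circ>\<^sub>m f \<in> Mor (EC n)"
      "defect (g \<circ>\<^sub>m f) = Suc (defect f)"
      "inj_on (\<lambda>x. the ((g \<circ>\<^sub>m f) x)) {x \<in> dom f. the ((g \<circ>\<^sub>m f) x) > 1}" .
  have "Poly_Mapping.single (g \<circ>\<^sub>m f) (1::'k) \<in>
      jacobson_radical (category_algebra (EC n)) [^]\<^bsub>ideals_set (category_algebra (EC n))\<^esub> Suc k"
    using EC.single_Comp_in_radical_pow[OF f(5) g(1,2)] g(3) by (simp add: EC_simps)
  then show ?case
    using g f by (intro bexI[of _ "g \<circ>\<^sub>m f"]) (simp_all add: dom_comp_eq)
qed

theorem has_loewy_length_EC:
  "has_loewy_length (category_algebra (EC n) :: ((nat \<rightharpoonup> nat) \<Rightarrow>\<^sub>0 'k::field) ring) ((n choose 2) + 1)"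
  using ex_chain defect_le by (intro EC.has_loewy_lengthI) blast+


section \<open>The isomorphism between the algebras of \<open>PC\<close> and \<open>EC\<close>\<close>

text \<open>The image of the monomial with coefficient \<open>c\<close> at \<open>f\<close>. For an
  infinite domain the sum takes the default value 0, which is why finiteness of domains is assumed
  below.\<close>

definition restrs :: "('a \<rightharpoonup> 'b) \<Rightarrow> 'k \<Rightarrow> ('a \<rightharpoonup> 'b) \<Rightarrow>\<^sub>0 'k::field" where
  "restrs f c = (\<Sum>A\<in>Pow (dom f). Poly_Mapping.single (f |` A) c)"

definition restr_map :: "(('a \<rightharpoonup> 'b) \<Rightarrow>\<^sub>0 'k) \<Rightarrow> ('a \<rightharpoonup> 'b) \<Rightarrow>\<^sub>0 'k::field" where
  "restr_map a = (\<Sum>f\<in>Poly_Mapping.keys a. restrs f (Poly_Mapping.lookup a f))"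

section \<open>Linearity of the restriction map\<close>

lemma restrs_0 [simp]: "restrs f 0 = 0"
  by (simp add: restrs_def)

lemma restrs_add: "restrs f (b + c) = restrs f b + restrs f c"
  by (simp add: restrs_def single_add sum.distrib)

lemma restr_map_superset:
  assumes "finite S" "Poly_Mapping.keys a \<subseteq> S"
  shows "restr_map a = (\<Sum>f\<in>S. restrs f (Poly_Mapping.lookup a f))"
  unfolding restr_map_def using assms
  by (intro sum.mono_neutral_left) (auto simp: in_keys_iff)

lemma restr_map_add: "restr_map (a + b) = restr_map a + restr_map b"
proof -
  let ?S = "Poly_Mapping.keys a \<union> Poly_Mapping.keys b"
  show ?thesis
    using keys_add[of a b]
    by (simp add: restr_map_superset[of ?S] lookup_add restrs_add flip: sum.distrib)
qed

lemma restr_map_0 [simp]: "restr_map 0 = 0"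
  by (simp add: restr_map_def)

lemma restr_map_diff: "restr_map (a - b) = restr_map a - restr_map b"
  using restr_map_add[of "a - b" b] by simp

lemma restr_map_sum: "restr_map (sum F S) = (\<Sum>i\<in>S. restr_map (F i))"
  by (induction S rule: infinite_finite_induct) (simp_all add: restr_map_add)

lemma restr_map_single: "restr_map (Poly_Mapping.single f c) = restrs f c"
  by (simp add: restr_map_superset[of "{f}"])

section \<open>Restrictions and composition\<close>

lemma dom_restrict_eq: "A \<subseteq> dom f \<Longrightarrow> dom (f |` A) = A"
  by auto

lemma restrict_dom: "f |` dom f = f"
  by (auto simp: restrict_map_def fun_eq_iff dom_def)

lemma subset_dom_comp_iff:
  "A \<subseteq> dom f \<Longrightarrow> A \<subseteq> dom (g \<circ>\<^sub>m f) \<longleftrightarrow> ran (f |` A) \<subseteq> dom g"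
  unfolding subset_iff dom_def ran_def restrict_map_def map_comp_def
  by (fastforce split: option.splits if_splits)

lemma restrict_comp: "(g |` ran (f |` A)) \<circ>\<^sub>m (f |` A) = (g \<circ>\<^sub>m f) |` A"
  by (auto simp: fun_eq_iff map_comp_def restrict_map_def ran_def split: option.splits)

text \<open>
  The product of \<open>g |` B\<close> and \<open>f |` A\<close> is nonzero only for \<open>B = f ` A\<close>, and such a
  \<open>B \<subseteq> dom g\<close> exists exactly when \<open>A\<close> lies in the domain of the partial composite.
\<close>

lemma restrs_comp:
  assumes "finite (dom f)" "finite (dom g)"
  shows "restrs (g \<circ>\<^sub>m f) (c * e) = pmul (\<lambda>g f. dom g = ran f) (\<lambda>g f. g \<circ>\<^sub>m f) (restrs g c) (restrs f e)"
proof -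
  let ?s = "\<lambda>A. Poly_Mapping.single ((g \<circ>\<^sub>m f) |` A) (c * e)"
  have "pmul (\<lambda>g f. dom g = ran f) (\<lambda>g f. g \<circ>\<^sub>m f) (restrs g c) (restrs f e) =
      (\<Sum>B\<in>Pow (dom g). \<Sum>A\<in>Pow (dom f). if B = ran (f |` A) then ?s A else 0)"
    unfolding restrs_def pmul_sum_left
    unfolding pmul_sum_right pmul_single
    by (intro sum.cong refl) (auto simp: dom_restrict_eq restrict_comp)
  \<comment> \<open>Since \<open>A\<close> determines \<open>B\<close>, the sum over
    \<open>B\<close> is moved inside, where at most one term survives.\<close>
  also have "\<dots> = (\<Sum>A\<in>Pow (dom f). \<Sum>B\<in>Pow (dom g). if B = ran (f |` A) then ?s A else 0)"
    by (rule sum.swap)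
  also have "\<dots> = (\<Sum>A\<in>Pow (dom f). if A \<in> Pow (dom (g \<circ>\<^sub>m f)) then ?s A else 0)"
    using assms(2) by (intro sum.cong refl) (auto simp: subset_dom_comp_iff)
  also have "\<dots> = (\<Sum>A\<in>Pow (dom f) \<inter> Pow (dom (g \<circ>\<^sub>m f)). ?s A)"
    using assms(1) by (simp only: sum.inter_restrict finite_Pow_iff)
  also have "Pow (dom f) \<inter> Pow (dom (g \<circ>\<^sub>m f)) = Pow (dom (g \<circ>\<^sub>m f))"
    by (rule Int_absorb1) (rule Pow_mono[OF dom_comp_subset])
  finally show ?thesis by (simp only: restrs_def)
qed

lemma restr_map_pmul:
  fixes a b :: "('a \<rightharpoonup> 'a) \<Rightarrow>\<^sub>0 'k::field"
  assumes "\<And>f. f \<in> Poly_Mapping.keys a \<union> Poly_Mapping.keys b \<Longrightarrow> finite (dom f)"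
  shows "restr_map (pmul (\<lambda>_ _. True) (\<lambda>g f. g \<circ>\<^sub>m f) a b) =
    pmul (\<lambda>g f. dom g = ran f) (\<lambda>g f. g \<circ>\<^sub>m f) (restr_map a) (restr_map b)"
proof -
  have "pmul (\<lambda>g f. dom g = ran f) (\<lambda>g f. g \<circ>\<^sub>m f) (restr_map a) (restr_map b) =
     (\<Sum>g\<in>Poly_Mapping.keys a. \<Sum>f\<in>Poly_Mapping.keys b.
       restrs (g \<circ>\<^sub>m f) (Poly_Mapping.lookup a g * Poly_Mapping.lookup b f))"
    unfolding restr_map_def pmul_sum_left unfolding pmul_sum_right
    using assms by (intro sum.cong refl restrs_comp[symmetric]) auto
  then show ?thesis by (simp add: pmul_def restr_map_sum restr_map_single)
qed

section \<open>Bijectivity of the restriction map\<close>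

lemma restrict_in_Mor_EC:
  assumes "f \<in> Mor (EC n)"
  shows "f |` A \<in> Mor (EC n)"
proof -
  have "dom (f |` A) \<subseteq> dom f" "ran (f |` A) \<subseteq> ran f"
    by (auto simp: ran_def restrict_map_def split: if_splits)
  moreover have "the ((f |` A) x) = the (f x)" if "x \<in> dom (f |` A)" for x
    using that by auto
  ultimately show ?thesis
    using assms unfolding mem_Mor_EC order_preserving_def order_decreasing_def mono_on_def
    by (smt (verit) order_trans subsetD)
qed

lemma Mor_EC_finite_dom: "f \<in> Mor (EC n) \<Longrightarrow> finite (dom f)"
  using finite_subset[of "dom f" "{1..n}"] by (simp add: mem_Mor_EC)

lemma restrs_in_filt: "f \<in> Mor (EC n) \<Longrightarrow> restrs f c \<in> EC.filt n 0"
  unfolding restrs_def by (intro EC.sum_in_filt) (auto simp: EC.filt_def restrict_in_Mor_EC)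

lemma restr_map_in_filt: "a \<in> EC.filt n 0 \<Longrightarrow> restr_map a \<in> EC.filt n 0"
  unfolding restr_map_def by (intro EC.sum_in_filt restrs_in_filt) (auto simp: EC.filt_def)

text \<open>A term of largest domain is not a proper restriction of any other term, so only its own
  trivial restriction contributes. This is the triangularity behind injectivity.\<close>

lemma lookup_restr_map_maximal:
  fixes a :: "('a \<rightharpoonup> 'b) \<Rightarrow>\<^sub>0 'k::field"
  assumes fin: "\<And>f. f \<in> Poly_Mapping.keys a \<Longrightarrow> finite (dom f)"
    and f: "f \<in> Poly_Mapping.keys a"
    and max: "\<And>g. g \<in> Poly_Mapping.keys a \<Longrightarrow> card (dom g) \<le> card (dom f)"
  shows "Poly_Mapping.lookup (restr_map a) f = Poly_Mapping.lookup a f"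
proof -
  have "Poly_Mapping.lookup (restrs g c) f = (if g = f then c else 0)" if g: "g \<in> Poly_Mapping.keys a"
    for g and c :: 'k
  proof -
    have "g |` A = f \<longleftrightarrow> g = f \<and> A = dom g" if A: "A \<in> Pow (dom g)" for A
    proof
      assume eq: "g |` A = f"
      have "A = dom f" using A by (auto simp flip: eq)
      \<comment> \<open>Here \<open>A\<close> is a subset of the finite set \<open>dom g\<close>
        and, by maximality of \<open>f\<close>, at least as large.\<close>
      then have "A = dom g"
        using A max[OF g] fin[OF g] by (simp add: card_seteq)
      then show "g = f \<and> A = dom g" using eq restrict_dom by metis
    qed (simp add: restrict_dom)
    then have "Poly_Mapping.lookup (restrs g c) f =
        (\<Sum>A\<in>Pow (dom g). if A = dom g then if g = f then c else 0 else 0)"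
      unfolding restrs_def lookup_sum
      by (intro sum.cong refl) (auto simp: lookup_single when_def)
    then show ?thesis using fin[OF g] by (simp add: sum.delta)
  qed
  then have "Poly_Mapping.lookup (restr_map a) f =
      (\<Sum>g\<in>Poly_Mapping.keys a. if g = f then Poly_Mapping.lookup a g else 0)"
    unfolding restr_map_def lookup_sum by (intro sum.cong refl) simp
  then show ?thesis using f by simp
qed

text \<open>A nonzero element has a term of largest domain, whose coefficient survives in the
  image.\<close>

lemma restr_map_eq_0:
  assumes "\<And>f. f \<in> Poly_Mapping.keys a \<Longrightarrow> finite (dom f)" "restr_map a = 0"
  shows "a = 0"
proof (rule ccontr)
  assume "a \<noteq> 0"
  then have ne: "(\<lambda>f. card (dom f)) ` Poly_Mapping.keys a \<noteq> {}" by simp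
  from Max_in[OF _ ne] obtain f where f: "f \<in> Poly_Mapping.keys a"
    "card (dom f) = Max ((\<lambda>f. card (dom f)) ` Poly_Mapping.keys a)" by auto
  then have "card (dom g) \<le> card (dom f)" if "g \<in> Poly_Mapping.keys a" for g
    using that by simp
  from lookup_restr_map_maximal[OF assms(1) f(1) this] show False
    using assms(2) f(1) by (simp add: in_keys_iff)
qed

text \<open>Strong induction on the size of the domain: \<open>restrs f c\<close> is the wanted
  monomial plus monomials at proper restrictions, which are already in the image.\<close>

lemma single_in_image_restr_map:
  assumes "f \<in> Mor (EC n)"
  shows "Poly_Mapping.single f c \<in> restr_map ` EC.filt n 0"
  using assms
proof (induction "card (dom f)" arbitrary: f rule: less_induct)
  case less
  let ?s = "\<lambda>A. Poly_Mapping.single (f |` A) c"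
  have fin: "finite (dom f)" using less.prems by (rule Mor_EC_finite_dom)
  have "\<forall>A\<in>Pow (dom f) - {dom f}. \<exists>b. b \<in> EC.filt n 0 \<and> ?s A = restr_map b"
  proof
    fix A assume A: "A \<in> Pow (dom f) - {dom f}"
    then have "dom (f |` A) \<subset> dom f" by auto
    from less.hyps[OF psubset_card_mono[OF fin this] restrict_in_Mor_EC[OF less.prems]]
    show "\<exists>b. b \<in> EC.filt n 0 \<and> ?s A = restr_map b" by blast
  qed
  then obtain b where b: "\<And>A. A \<in> Pow (dom f) - {dom f} \<Longrightarrow> b A \<in> EC.filt n 0 \<and> ?s A = restr_map (b A)"
    by metis
  let ?b = "\<Sum>A\<in>Pow (dom f) - {dom f}. b A"
  have "restrs f c = Poly_Mapping.single f c + (\<Sum>A\<in>Pow (dom f) - {dom f}. ?s A)"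
    unfolding restrs_def using fin by (subst sum.remove[of _ "dom f"]) (auto simp: restrict_dom)
  also have "(\<Sum>A\<in>Pow (dom f) - {dom f}. ?s A) = restr_map ?b"
    unfolding restr_map_sum using b by (intro sum.cong) auto
  finally have "Poly_Mapping.single f c = restr_map (Poly_Mapping.single f c - ?b)"
    by (simp add: restr_map_diff restr_map_single)
  moreover have "Poly_Mapping.single f c + - ?b \<in> EC.filt n 0"
    using less.prems b by (intro EC.add_in_filt EC.uminus_in_filt EC.sum_in_filt) (auto simp: EC.filt_def)
  ultimately show ?case by simp
qed

lemma restr_map_image: "restr_map ` EC.filt n 0 = EC.filt n 0"
proof
  show "EC.filt n 0 \<subseteq> restr_map ` EC.filt n 0"
  proof
    fix a :: "(nat \<rightharpoonup> nat) \<Rightarrow>\<^sub>0 'k::field" assume a: "a \<in> EC.filt n 0"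
    have "\<forall>f\<in>Poly_Mapping.keys a. \<exists>b. b \<in> EC.filt n 0 \<and>
        Poly_Mapping.single f (Poly_Mapping.lookup a f) = restr_map b"
      using a single_in_image_restr_map unfolding EC.filt_def by blast
    then obtain b where b: "\<And>f. f \<in> Poly_Mapping.keys a \<Longrightarrow> b f \<in> EC.filt n 0 \<and>
        Poly_Mapping.single f (Poly_Mapping.lookup a f) = restr_map (b f)"
      by metis
    have "a = restr_map (\<Sum>f\<in>Poly_Mapping.keys a. b f)"
      using b by (subst expand_singles) (simp add: restr_map_sum)
    moreover have "(\<Sum>f\<in>Poly_Mapping.keys a. b f) \<in> EC.filt n 0"
      by (rule EC.sum_in_filt) (use b in blast)
    ultimately show "a \<in> restr_map ` EC.filt n 0" by (rule image_eqI)
  qed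
qed (use restr_map_in_filt in blast)

text \<open>Every partial map is onto its own range, so the two algebras live on the same space of
  formal combinations and differ only in unit and product.\<close>

lemma carrier_PC: "carrier (PC n) = Mor (EC n)"
  unfolding set_eq_iff mem_Mor_EC by (simp add: PC_def)

lemma monoid_algebra_PC_simps:
  "carrier (monoid_algebra (PC n)) = EC.filt n 0"
  "x \<otimes>\<^bsub>monoid_algebra (PC n)\<^esub> y = pmul (\<lambda>_ _. True) (\<lambda>g f. g \<circ>\<^sub>m f) x y"
  "x \<oplus>\<^bsub>monoid_algebra (PC n)\<^esub> y = x + y"
  "\<one>\<^bsub>monoid_algebra (PC n)\<^esub> = Poly_Mapping.single (Some |` {1..n}) 1"
  by (simp_all add: monoid_algebra_def EC.filt_def carrier_PC pmul_def) (simp_all add: PC_def)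

theorem restr_map_ring_iso:
  "restr_map \<in> ring_iso (monoid_algebra (PC n) :: ((nat \<rightharpoonup> nat) \<Rightarrow>\<^sub>0 'k::field) ring) (category_algebra (EC n))"
  (is "_ \<in> ring_iso ?R ?S")
proof (rule ring_iso_memI)
  show "bij_betw restr_map (carrier ?R) (carrier ?S)"
    unfolding bij_betw_def monoid_algebra_PC_simps EC.category_algebra_simps
  proof (intro conjI restr_map_image inj_onI)
    fix a b :: "(nat \<rightharpoonup> nat) \<Rightarrow>\<^sub>0 'k"
    assume ab: "a \<in> EC.filt n 0" "b \<in> EC.filt n 0" "restr_map a = restr_map b"
    have "a + - b \<in> EC.filt n 0" using ab by (intro EC.add_in_filt EC.uminus_in_filt)
    then have "finite (dom f)" if "f \<in> Poly_Mapping.keys (a - b)" for f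
      using that by (intro Mor_EC_finite_dom) (auto simp: EC.filt_def)
    moreover have "restr_map (a - b) = 0" using ab(3) by (simp add: restr_map_diff)
    ultimately have "a - b = 0" by (rule restr_map_eq_0)
    then show "a = b" by simp
  qed
  \<comment> \<open>The restrictions of the identity on \<open>{1..n}\<close> are exactly the
    identities of the objects, whose sum is the unit of the category algebra.\<close>
  show "restr_map \<one>\<^bsub>?R\<^esub> = \<one>\<^bsub>?S\<^esub>"
    by (auto simp: monoid_algebra_PC_simps restr_map_single restrs_def category_algebra_def EC_simps
        Int_absorb1 intro!: sum.cong)
next
  fix a b :: "(nat \<rightharpoonup> nat) \<Rightarrow>\<^sub>0 'k"
  assume "a \<in> carrier ?R" "b \<in> carrier ?R"
  then show "restr_map (a \<otimes>\<^bsub>?R\<^esub> b) = restr_map a \<otimes>\<^bsub>?S\<^esub> restr_map b"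
    unfolding monoid_algebra_PC_simps EC.category_algebra_simps EC_simps
    by (intro restr_map_pmul) (auto simp: EC.filt_def intro: Mor_EC_finite_dom)
qed (simp_all add: monoid_algebra_PC_simps EC.category_algebra_simps restr_map_in_filt restr_map_add)

theorem proposition4p34:
  fixes n :: nat
  assumes "n \<ge> 1"
  shows "has_loewy_length (category_algebra (EC n) :: ((nat \<rightharpoonup> nat) \<Rightarrow>\<^sub>0 'k::field) ring)
           ((n choose 2) + 1)
    \<and> has_loewy_length (monoid_algebra (PC n) :: ((nat \<rightharpoonup> nat) \<Rightarrow>\<^sub>0 'k::field) ring)
           ((n choose 2) + 1)"
proof -
  interpret ring_isomorphism "monoid_algebra (PC n) :: ((nat \<rightharpoonup> nat) \<Rightarrow>\<^sub>0 'k) ring"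
    "category_algebra (EC n)" restr_map
    by (intro ring_isomorphism.intro ring_isomorphism_axioms.intro ring_monoid_algebra monoid_PC
        ring_category_algebra finite_category_EC restr_map_ring_iso)
  show ?thesis using has_loewy_length_EC has_loewy_length_iff by blast
qed

end
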